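(* In the setting described in the context, there exists an integer matrix $B = \begin{pmatrix} a_1 & b_1 \\ a_2 & b_2 \end{pmatrix} \in \mathbb{Z}^{2\times 2}$ such that $\rho_1^{a_1}\rho_2^{a_2} = \mathbf{1} = \rho_1^{b_1}\rho_2^{b_2}$ and $\det(B) = n$. Such a matrix is unique up to right multiplication by $\mathrm{SL}_2(\mathbb{Z})$.
   Context: Let $\Bbbk$ be algebraically closed of characteristic $0$, $R=\Bbbk[X_1,X_2,X_3]$, and $G\le \mathrm{SL}_3(\Bbbk)$ a finite abelian group of order $n$ acting on $R$ by linear change of variables, such that the skew-group algebra $R\ast G$ admits a higher preprojective grading (standing assumption). Decompose the natural representation of $G$ on $\Bbbk^3$ as $\rho=\rho_1\oplus\rho_2\oplus\rho_3$ into one-dimensional characters; these are elements of the character group $\hat G=\mathrm{Hom}(G,\Bbbk^* )$ (with multiplication of characters), and $\mathbf{1}$ denotes the trivial character. *)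

theory Defs
  imports "HOL-Analysis.Analysis" "HOL-Computational_Algebra.Polynomial"
begin

text \<open>Finite subgroups of SL_3(k), realised as sets of 3x3 matrices.\<close>
definition subgroup_SL3 :: "('k::field ^3^3) set \<Rightarrow> bool" where
  "subgroup_SL3 G \<longleftrightarrow> mat 1 \<in> G \<and> (\<forall>g\<in>G. det g = 1)
     \<and> (\<forall>g\<in>G. \<forall>h\<in>G. g ** h \<in> G)
     \<and> (\<forall>g\<in>G. \<exists>h\<in>G. g ** h = mat 1 \<and> h ** g = mat 1)"

definition diag3 :: "'k::zero \<Rightarrow> 'k \<Rightarrow> 'k \<Rightarrow> 'k^3^3" where
  "diag3 a b c = (\<chi> i j. if i = j then (if i = 1 then a else if i = 2 then b else c) else 0)"

text \<open>The natural representation decomposes as rho1 + rho2 + rho3 w.r.t. the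
  basis given by the columns of the invertible matrix P:
  every g in G equals P diag(rho1 g, rho2 g, rho3 g) P^-1.\<close>
definition char_decomposition ::
  "('k::field ^3^3) set \<Rightarrow> 'k^3^3 \<Rightarrow> ('k^3^3 \<Rightarrow> 'k) \<Rightarrow> ('k^3^3 \<Rightarrow> 'k) \<Rightarrow> ('k^3^3 \<Rightarrow> 'k) \<Rightarrow> bool"
  where
  "char_decomposition G P r1 r2 r3 \<longleftrightarrow> invertible P \<and>
     (\<forall>g\<in>G. g ** P = P ** diag3 (r1 g) (r2 g) (r3 g))"

text \<open>Column j of B gives a relation rho1^(B_1j) rho2^(B_2j) = 1 in the character group.\<close>
definition relation_matrix ::
  "('k::field ^3^3) set \<Rightarrow> ('k^3^3 \<Rightarrow> 'k) \<Rightarrow> ('k^3^3 \<Rightarrow> 'k) \<Rightarrow> int^2^2 \<Rightarrow> bool" where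
  "relation_matrix G r1 r2 B \<longleftrightarrow>
     (\<forall>j. \<forall>g\<in>G. r1 g powi (B $ 1 $ j) * r2 g powi (B $ 2 $ j) = 1)"

end

theory Submission
  imports Defs "HOL-Algebra.Multiplicative_Group"
begin

text \<open>
  Since \<open>\<rho>\<^sub>3 = (\<rho>\<^sub>1\<rho>\<^sub>2)\<^sup>-\<^sup>1\<close>, the pair \<open>(\<rho>\<^sub>1, \<rho>\<^sub>2)\<close> embeds \<open>G\<close> into \<open>k\<^sup>* \<times> k\<^sup>*\<close>, and
  the relations \<open>(a, b)\<close> with \<open>\<rho>\<^sub>1\<^sup>a \<rho>\<^sub>2\<^sup>b = 1\<close> form a lattice \<open>L \<subseteq> \<int>\<^sup>2\<close>.
  Let \<open>d\<close> be the order of \<open>\<rho>\<^sub>2\<close> and \<open>e\<close> the order of \<open>\<rho>\<^sub>1\<close> on \<open>K = ker \<rho>\<^sub>2\<close>.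
  Counting with character sums gives \<open>|G| = d |K|\<close> and, \<open>\<rho>\<^sub>1\<close> being injective on \<open>K\<close>,
  \<open>|K| = e\<close>; orthogonality of characters yields \<open>c\<close> with \<open>\<rho>\<^sub>1\<^sup>e = \<rho>\<^sub>2\<^sup>c\<close>.
  Then \<open>(e, -c)\<close> and \<open>(0, d)\<close> form a basis of \<open>L\<close> of determinant \<open>ed = n\<close>, and the
  integer matrices of determinant \<open>n\<close> with columns in \<open>L\<close> are exactly the products of this
  basis with \<open>SL\<^sub>2(\<int>)\<close>.
\<close>

section \<open>Characters of finite groups\<close>

definition character :: "('a, 'b) monoid_scheme \<Rightarrow> ('a \<Rightarrow> 'k::field) \<Rightarrow> bool" where
  "character G \<phi> \<longleftrightarrow> (\<forall>x\<in>carrier G. \<phi> x \<noteq> 0)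
     \<and> (\<forall>x\<in>carrier G. \<forall>y\<in>carrier G. \<phi> (x \<otimes>\<^bsub>G\<^esub> y) = \<phi> x * \<phi> y)"

lemma character_mult:
  "character G \<phi> \<Longrightarrow> character G \<psi> \<Longrightarrow> character G (\<lambda>x. \<phi> x * \<psi> x)"
  by (simp add: character_def mult_ac)

lemma character_power: "character G \<phi> \<Longrightarrow> character G (\<lambda>x. \<phi> x ^ k)"
  by (simp add: character_def power_mult_distrib)

lemma character_inverse: "character G \<phi> \<Longrightarrow> character G (\<lambda>x. inverse (\<phi> x))"
  by (simp add: character_def)

lemma character_restrict:
  "character G \<phi> \<Longrightarrow> H \<subseteq> carrier G \<Longrightarrow> character (G\<lparr>carrier := H\<rparr>) \<phi>"
  by (auto simp: character_def)

definition char_order :: "('a, 'b) monoid_scheme \<Rightarrow> ('a \<Rightarrow> 'k::field) \<Rightarrow> nat" where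
  "char_order G \<phi> = (LEAST d. 0 < d \<and> (\<forall>x\<in>carrier G. \<phi> x ^ d = 1))"

definition char_kernel :: "('a, 'b) monoid_scheme \<Rightarrow> ('a \<Rightarrow> 'k::field) \<Rightarrow> 'a set" where
  "char_kernel G \<phi> = {x \<in> carrier G. \<phi> x = 1}"

lemma sum_powers_root_of_unity:
  fixes z :: "'k::field"
  assumes "z ^ d = 1"
  shows "(\<Sum>b<d. z ^ b) = (if z = 1 then of_nat d else 0)"
  using assms by (simp add: sum_gp_strict)

locale finite_group = group +
  assumes finite_carrier: "finite (carrier G)"

lemma (in monoid) character_one: "character G \<phi> \<Longrightarrow> \<phi> \<one> = 1"
  using mult_cancel_left2[of "\<phi> \<one>" "\<phi> \<one>"] unfolding character_def
  by (metis l_one one_closed)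

lemma (in monoid) character_nat_pow:
  assumes "character G \<phi>" "x \<in> carrier G"
  shows "\<phi> (x [^] n) = \<phi> x ^ n"
  using assms by (induction n) (simp_all add: character_one character_def)

lemma (in group) subgroup_char_kernel:
  assumes "character G \<phi>"
  shows "subgroup (char_kernel G \<phi>) G"
proof (rule subgroupI)
  have mult: "\<phi> (x \<otimes> y) = \<phi> x * \<phi> y" if "x \<in> carrier G" "y \<in> carrier G" for x y
    using assms that by (simp add: character_def)
  have inv: "\<phi> (inv x) = inverse (\<phi> x)" if "x \<in> carrier G" for x
  proof -
    have "\<phi> x * \<phi> (inv x) = 1"
      using mult[OF that inv_closed[OF that]] character_one[OF assms] that by simp
    then show ?thesis by (simp add: inverse_unique)
  qed
  show "inv x \<in> char_kernel G \<phi>" if "x \<in> char_kernel G \<phi>" for x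
    using that inv by (simp add: char_kernel_def)
  show "x \<otimes> y \<in> char_kernel G \<phi>" if "x \<in> char_kernel G \<phi>" "y \<in> char_kernel G \<phi>" for x y
    using that mult by (simp add: char_kernel_def)
  show "char_kernel G \<phi> \<noteq> {}"
    using character_one[OF assms] by (auto simp: char_kernel_def)
qed (auto simp: char_kernel_def)

context finite_group
begin

lemma order_pos: "0 < order G"
  using finite_carrier order_gt_0_iff_finite by blast

lemma finite_group_subgroup: "subgroup H G \<Longrightarrow> finite_group (G\<lparr>carrier := H\<rparr>)"
  by (simp add: finite_group.intro finite_group_axioms_def subgroup_imp_group
      finite_subset[OF subgroup.subset finite_carrier])

lemma character_pow_order:
  assumes "character G \<phi>" "x \<in> carrier G"
  shows "\<phi> x ^ order G = 1"
  using assms pow_order_eq_1[OF assms(2)] by (simp flip: character_nat_pow add: character_one)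

lemma sum_character_eq_0:
  assumes "character G \<phi>" "a \<in> carrier G" "\<phi> a \<noteq> 1"
  shows "(\<Sum>x\<in>carrier G. \<phi> x) = 0"
proof -
  have "(\<Sum>x\<in>carrier G. \<phi> x) = (\<Sum>x\<in>(\<lambda>x. a \<otimes> x) ` carrier G. \<phi> x)"
    using surj_const_mult[OF assms(2)] by simp
  also have "\<dots> = (\<Sum>x\<in>carrier G. \<phi> (a \<otimes> x))"
    using inj_on_cmult[OF assms(2)] by (simp add: sum.reindex)
  also have "\<dots> = \<phi> a * (\<Sum>x\<in>carrier G. \<phi> x)"
    using assms(1,2) by (simp add: character_def sum_distrib_left)
  finally show ?thesis using assms(3) by (simp add: algebra_simps)
qed

lemma
  assumes "character G \<phi>"
  shows char_order_pos: "0 < char_order G \<phi>"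
    and character_pow_char_order: "x \<in> carrier G \<Longrightarrow> \<phi> x ^ char_order G \<phi> = 1"
proof -
  have "0 < order G \<and> (\<forall>x\<in>carrier G. \<phi> x ^ order G = 1)"
    using order_pos character_pow_order[OF assms] by blast
  then have "0 < char_order G \<phi> \<and> (\<forall>x\<in>carrier G. \<phi> x ^ char_order G \<phi> = 1)"
    unfolding char_order_def by (rule LeastI)
  then show "0 < char_order G \<phi>" "x \<in> carrier G \<Longrightarrow> \<phi> x ^ char_order G \<phi> = 1" by auto
qed

lemma char_order_least:
  assumes "0 < b" "b < char_order G \<phi>"
  obtains x where "x \<in> carrier G" "\<phi> x ^ b \<noteq> 1"
  using not_less_Least[of b "\<lambda>d. 0 < d \<and> (\<forall>x\<in>carrier G. \<phi> x ^ d = 1)"] assms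
  unfolding char_order_def by blast

lemma powi_eq_1_iff_char_order_dvd:
  assumes "character G \<phi>"
  shows "(\<forall>x\<in>carrier G. \<phi> x powi a = 1) \<longleftrightarrow> int (char_order G \<phi>) dvd a"
proof
  define d where "d = char_order G \<phi>"
  have nz: "\<phi> x \<noteq> 0" if "x \<in> carrier G" for x
    using assms that by (simp add: character_def)
  have pow_d: "\<phi> x powi (int d * q) = 1" if "x \<in> carrier G" for x q
    using character_pow_char_order[OF assms that] by (simp add: d_def power_int_mult)
  show "int d dvd a" if a: "\<forall>x\<in>carrier G. \<phi> x powi a = 1"
  proof -
    define r where "r = a mod int d"
    have r: "0 \<le> r" "r < int d" using char_order_pos[OF assms] by (auto simp: r_def d_def)
    have "\<phi> x ^ nat r = 1" if "x \<in> carrier G" for x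
    proof -
      have "\<phi> x ^ nat r = \<phi> x powi (int d * (a div int d)) * \<phi> x powi r"
        using pow_d[OF that] r(1) by (simp add: power_int_def)
      also have "\<dots> = \<phi> x powi (int d * (a div int d) + r)"
        using nz[OF that] by (simp add: power_int_add)
      also have "\<dots> = 1" using a that by (simp add: r_def)
      finally show ?thesis .
    qed
    then have "nat r = 0"
      using char_order_least[of "nat r" \<phi>] r by (fastforce simp: d_def)
    then show ?thesis using r by (simp add: r_def dvd_eq_mod_eq_0)
  qed
  show "\<forall>x\<in>carrier G. \<phi> x powi a = 1" if "int d dvd a"
    using that pow_d by (auto elim: dvdE)
qed

lemma order_eq_char_order_mult_card_kernel:
  fixes \<phi> :: "'a \<Rightarrow> 'k::field_char_0"
  assumes "character G \<phi>"
  shows "order G = char_order G \<phi> * card (char_kernel G \<phi>)"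
proof -
  \<comment> \<open>Count \<open>\<Sum>x. \<Sum>b<d. \<phi>(x)\<^sup>b\<close> in two ways; for \<open>0 < b < d\<close> the character
    \<open>\<phi>\<^sup>b\<close> is nontrivial.\<close>
  define d where "d = char_order G \<phi>"
  have "(\<Sum>x\<in>carrier G. \<Sum>b<d. \<phi> x ^ b) = (\<Sum>x\<in>carrier G. if \<phi> x = 1 then (of_nat d :: 'k) else 0)"
    using character_pow_char_order[OF assms] by (intro sum.cong) (auto simp: d_def sum_powers_root_of_unity)
  also have "\<dots> = of_nat d * of_nat (card (char_kernel G \<phi>))"
    using finite_carrier by (simp add: sum.If_cases char_kernel_def Collect_conj_eq Int_commute)
  finally have kernel_count: "(\<Sum>x\<in>carrier G. \<Sum>b<d. \<phi> x ^ b) = of_nat (d * card (char_kernel G \<phi>))"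
    by simp
  have "(\<Sum>x\<in>carrier G. \<Sum>b<d. \<phi> x ^ b) = (\<Sum>b<d. \<Sum>x\<in>carrier G. \<phi> x ^ b)"
    by (rule sum.swap)
  also have "\<dots> = (\<Sum>b<d. if b = 0 then of_nat (order G) else 0)"
  proof (intro sum.cong refl)
    fix b assume "b \<in> {..<d}"
    moreover have "(\<Sum>x\<in>carrier G. \<phi> x ^ b) = 0" if "0 < b" "b < d"
      using char_order_least[of b \<phi>] that sum_character_eq_0[OF character_power[OF assms]]
      by (metis d_def)
    ultimately show "(\<Sum>x\<in>carrier G. \<phi> x ^ b) = (if b = 0 then of_nat (order G) else 0)"
      by (auto simp: order_def)
  qed
  also have "\<dots> = of_nat (order G)"
    using char_order_pos[OF assms] by (simp add: d_def)
  finally show ?thesis using kernel_count by (metis d_def of_nat_eq_iff of_nat_mult)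
qed

lemma character_eq_power_if_trivial_on_kernel:
  fixes \<phi> \<psi> :: "'a \<Rightarrow> 'k::field_char_0"
  assumes "character G \<phi>" "character G \<psi>"
    and "\<forall>x\<in>char_kernel G \<psi>. \<phi> x = 1"
  obtains c where "\<forall>x\<in>carrier G. \<phi> x = \<psi> x ^ c"
proof -
  \<comment> \<open>\<open>\<Sum>c<d. \<Sum>x. \<phi>(x) \<psi>(x)\<^sup>-\<^sup>c = |G| \<noteq> 0\<close>, so some character \<open>\<phi> \<psi>\<^sup>-\<^sup>c\<close> has nonzero sum,
    hence is trivial.\<close>
  define d where "d = char_order G \<psi>"
  define S where "S c = (\<Sum>x\<in>carrier G. \<phi> x * inverse (\<psi> x) ^ c)" for c
  have "(\<Sum>c<d. S c) = (\<Sum>x\<in>carrier G. \<phi> x * (\<Sum>c<d. inverse (\<psi> x) ^ c))"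
    unfolding S_def by (subst sum.swap) (simp add: sum_distrib_left)
  also have "\<dots> = (\<Sum>x\<in>carrier G. if \<psi> x = 1 then (of_nat d :: 'k) else 0)"
  proof (intro sum.cong refl)
    fix x assume x: "x \<in> carrier G"
    have "inverse (\<psi> x) ^ d = 1"
      using character_pow_char_order[OF assms(2) x] by (simp add: d_def power_inverse)
    then show "\<phi> x * (\<Sum>c<d. inverse (\<psi> x) ^ c) = (if \<psi> x = 1 then of_nat d else 0)"
      using assms(3) x by (auto simp: sum_powers_root_of_unity char_kernel_def)
  qed
  also have "\<dots> = of_nat (order G)"
    using order_eq_char_order_mult_card_kernel[OF assms(2)] finite_carrier
    by (simp add: sum.If_cases char_kernel_def Collect_conj_eq Int_commute d_def)
  finally have "(\<Sum>c<d. S c) \<noteq> 0" using order_pos by simp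
  then obtain c where "S c \<noteq> 0" by (meson sum.neutral)
  have "\<phi> x * inverse (\<psi> x) ^ c = 1" if "x \<in> carrier G" for x
    using sum_character_eq_0[OF character_mult[OF assms(1)
        character_power[OF character_inverse[OF assms(2)]]] that] \<open>S c \<noteq> 0\<close>
    by (auto simp: S_def)
  then have "\<forall>x\<in>carrier G. \<phi> x = \<psi> x ^ c"
    using assms(2) by (simp add: character_def field_simps power_inverse)
  then show ?thesis using that by blast
qed

lemma
  assumes "character G \<psi>"
  shows finite_group_char_kernel: "finite_group (G\<lparr>carrier := char_kernel G \<psi>\<rparr>)"
    and character_restrict_char_kernel:
      "character G \<phi> \<Longrightarrow> character (G\<lparr>carrier := char_kernel G \<psi>\<rparr>) \<phi>"
  using finite_group_subgroup[OF subgroup_char_kernel[OF assms]] character_restrict[of G \<phi>]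
  by (auto simp: char_kernel_def)

lemma card_char_kernel_eq_char_order:
  fixes \<phi> \<psi> :: "'a \<Rightarrow> 'k::field_char_0"
  assumes "character G \<phi>" "character G \<psi>"
    and "\<forall>x\<in>carrier G. \<phi> x = 1 \<longrightarrow> \<psi> x = 1 \<longrightarrow> x = \<one>"
  shows "card (char_kernel G \<psi>) = char_order (G\<lparr>carrier := char_kernel G \<psi>\<rparr>) \<phi>"
proof -
  let ?K = "G\<lparr>carrier := char_kernel G \<psi>\<rparr>"
  have kernel_trivial: "char_kernel ?K \<phi> = {\<one>}"
    using assms(3) character_one[OF assms(1)] character_one[OF assms(2)]
    by (auto simp: char_kernel_def)
  have "order ?K = char_order ?K \<phi> * card (char_kernel ?K \<phi>)"
    using finite_group_char_kernel[OF assms(2)] character_restrict_char_kernel[OF assms(2,1)]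
    by (rule finite_group.order_eq_char_order_mult_card_kernel)
  then show ?thesis using kernel_trivial by (simp add: order_def)
qed

end

section \<open>The relation lattice of two characters\<close>

definition relation_lattice ::
  "('a, 'b) monoid_scheme \<Rightarrow> ('a \<Rightarrow> 'k::field) \<Rightarrow> ('a \<Rightarrow> 'k) \<Rightarrow> (int^2) set" where
  "relation_lattice G \<phi> \<psi> = {v. \<forall>x\<in>carrier G. \<phi> x powi v$1 * \<psi> x powi v$2 = 1}"

definition lower_triangular_2x2 :: "'a \<Rightarrow> 'a \<Rightarrow> 'a \<Rightarrow> 'a::zero^2^2" where
  "lower_triangular_2x2 a b c = vector [vector [a, 0], vector [b, c]]"

lemma lower_triangular_2x2_mult_vec:
  "(lower_triangular_2x2 a b c *v w)$1 = a * w$1"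
  "(lower_triangular_2x2 a b c *v w)$2 = b * w$1 + c * w$2"
  by (simp_all add: lower_triangular_2x2_def matrix_vector_mult_def sum_2)

lemma det_lower_triangular_2x2: "det (lower_triangular_2x2 a b c) = a * (c :: 'a::comm_ring_1)"
  by (simp add: lower_triangular_2x2_def det_2)

context finite_group
begin

lemma range_lower_triangular_subset_relation_lattice:
  assumes \<psi>: "character G \<psi>"
    and c: "\<forall>x\<in>carrier G. \<phi> x ^ e = \<psi> x ^ c"
  shows "range ((*v) (lower_triangular_2x2 (int e) (- int c) (int (char_order G \<psi>))))
    \<subseteq> relation_lattice G \<phi> \<psi>"
proof clarify
  fix w
  let ?v = "lower_triangular_2x2 (int e) (- int c) (int (char_order G \<psi>)) *v w"
  have "\<phi> x powi ?v$1 * \<psi> x powi ?v$2 = 1" if x: "x \<in> carrier G" for x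
  proof -
    have nz: "\<psi> x \<noteq> 0"
      using \<psi> x by (simp add: character_def)
    have "\<psi> x powi (int (char_order G \<psi>) * w$2) = 1"
      using powi_eq_1_iff_char_order_dvd[OF \<psi>, of "int (char_order G \<psi>) * w$2"] x by simp
    moreover have "\<psi> x powi ?v$2 = \<psi> x powi (- (int c * w$1)) * \<psi> x powi (int (char_order G \<psi>) * w$2)"
      using nz by (subst power_int_add[symmetric]) (simp_all add: lower_triangular_2x2_mult_vec)
    moreover have "\<phi> x powi ?v$1 = \<psi> x powi (int c * w$1)"
      using c x by (simp add: lower_triangular_2x2_mult_vec power_int_mult)
    ultimately show ?thesis
      using nz by (simp add: power_int_minus)
  qed
  then show "?v \<in> relation_lattice G \<phi> \<psi>"
    by (simp add: relation_lattice_def)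
qed

lemma relation_lattice_subset_range_lower_triangular:
  fixes \<phi> \<psi> :: "'a \<Rightarrow> 'k::field_char_0"
  defines "e \<equiv> char_order (G\<lparr>carrier := char_kernel G \<psi>\<rparr>) \<phi>"
  assumes \<phi>: "character G \<phi>" and \<psi>: "character G \<psi>"
    and c: "\<forall>x\<in>carrier G. \<phi> x ^ e = \<psi> x ^ c"
  shows "relation_lattice G \<phi> \<psi>
    \<subseteq> range ((*v) (lower_triangular_2x2 (int e) (- int c) (int (char_order G \<psi>))))"
proof
  fix v assume "v \<in> relation_lattice G \<phi> \<psi>"
  then have v: "\<phi> x powi v$1 * \<psi> x powi v$2 = 1" if "x \<in> carrier G" for x
    using that by (simp add: relation_lattice_def)
  have "\<forall>x\<in>char_kernel G \<psi>. \<phi> x powi v$1 = 1"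
    using v by (fastforce simp: char_kernel_def)
  then have "int e dvd v$1"
    using finite_group.powi_eq_1_iff_char_order_dvd[OF finite_group_char_kernel[OF \<psi>]
        character_restrict_char_kernel[OF \<psi> \<phi>]]
    by (simp add: e_def)
  then obtain q where q: "v$1 = int e * q" by (elim dvdE)
  have "\<forall>x\<in>carrier G. \<psi> x powi (int c * q + v$2) = 1"
    using v c \<phi> \<psi> q by (simp add: character_def power_int_add power_int_mult)
  then have "int (char_order G \<psi>) dvd int c * q + v$2"
    by (rule powi_eq_1_iff_char_order_dvd[OF \<psi>, THEN iffD1])
  then obtain q' where "int c * q + v$2 = int (char_order G \<psi>) * q'" by (elim dvdE)
  then have "v = lower_triangular_2x2 (int e) (- int c) (int (char_order G \<psi>)) *v vector [q, q']"
    using q by (simp add: vec_eq_iff forall_2 lower_triangular_2x2_mult_vec algebra_simps)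
  then show "v \<in> range ((*v) (lower_triangular_2x2 (int e) (- int c) (int (char_order G \<psi>))))"
    by blast
qed

theorem relation_lattice_eq_range:
  fixes \<phi> \<psi> :: "'a \<Rightarrow> 'k::field_char_0"
  assumes \<phi>: "character G \<phi>" and \<psi>: "character G \<psi>"
    and faithful: "\<forall>x\<in>carrier G. \<phi> x = 1 \<longrightarrow> \<psi> x = 1 \<longrightarrow> x = \<one>"
  obtains B :: "int^2^2"
  where "det B = int (order G)" "relation_lattice G \<phi> \<psi> = range ((*v) B)"
proof -
  define e where "e = char_order (G\<lparr>carrier := char_kernel G \<psi>\<rparr>) \<phi>"
  have "\<forall>x\<in>char_kernel G \<psi>. \<phi> x ^ e = 1"
    using finite_group.character_pow_char_order[OF finite_group_char_kernel[OF \<psi>]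
        character_restrict_char_kernel[OF \<psi> \<phi>]]
    by (simp add: e_def)
  then obtain c where c: "\<forall>x\<in>carrier G. \<phi> x ^ e = \<psi> x ^ c"
    using character_eq_power_if_trivial_on_kernel[OF character_power[OF \<phi>] \<psi>] by blast
  let ?B = "lower_triangular_2x2 (int e) (- int c) (int (char_order G \<psi>))"
  have "relation_lattice G \<phi> \<psi> = range ((*v) ?B)"
    using range_lower_triangular_subset_relation_lattice[OF \<psi> c]
      relation_lattice_subset_range_lower_triangular[OF \<phi> \<psi> c[unfolded e_def]]
    by (simp add: e_def)
  moreover have "det ?B = int (order G)"
    using order_eq_char_order_mult_card_kernel[OF \<psi>] card_char_kernel_eq_char_order[OF \<phi> \<psi> faithful]
    by (simp add: det_lower_triangular_2x2 e_def)
  ultimately show ?thesis using that by blast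
qed

end

section \<open>Bases of integer lattices\<close>

lemma column_matrix_mult: "column j (A ** B) = A *v column j B"
  by (simp add: column_def matrix_matrix_mult_def matrix_vector_mult_def vec_eq_iff)

lemma columns_in_range_det_eq_iff:
  fixes A B :: "'a::idom^'n^'n"
  assumes "det A \<noteq> 0"
  shows "(\<forall>j. column j B \<in> range ((*v) A)) \<and> det B = det A \<longleftrightarrow> (\<exists>S. det S = 1 \<and> B = A ** S)"
proof
  assume B: "(\<forall>j. column j B \<in> range ((*v) A)) \<and> det B = det A"
  then have "\<forall>j. \<exists>w. column j B = A *v w" by blast
  then obtain w where w: "\<And>j. column j B = A *v w j" by metis
  define S :: "'a^'n^'n" where "S = (\<chi> i j. w j $ i)"
  have "column j B = column j (A ** S)" for j
    by (simp add: column_matrix_mult w) (simp add: S_def column_def)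
  then have "B = A ** S"
    by (simp add: column_def vec_eq_iff)
  moreover have "det S = 1"
    using B assms by (simp add: \<open>B = A ** S\<close> det_mul)
  ultimately show "\<exists>S. det S = 1 \<and> B = A ** S" by blast
next
  assume "\<exists>S. det S = 1 \<and> B = A ** S"
  then show "(\<forall>j. column j B \<in> range ((*v) A)) \<and> det B = det A"
    by (auto simp: column_matrix_mult det_mul)
qed

lemma SL2_right_inverse:
  fixes S :: "'a::comm_ring_1^2^2"
  assumes "det S = 1"
  obtains T where "S ** T = mat 1" "det T = 1"
proof
  let ?T = "vector [vector [S$2$2, - S$1$2], vector [- S$2$1, S$1$1]] :: 'a^2^2"
  show "S ** ?T = mat 1"
    using assms by (simp add: vec_eq_iff forall_2 matrix_matrix_mult_def sum_2 mat_def det_2 algebra_simps)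
  show "det ?T = 1"
    using assms by (simp add: det_2 algebra_simps)
qed

lemma SL2_coset_eq:
  fixes A B S\<^sub>0 :: "'a::comm_ring_1^2^2"
  assumes "det S\<^sub>0 = 1"
  shows "(\<exists>S. det S = 1 \<and> B = A ** S\<^sub>0 ** S) \<longleftrightarrow> (\<exists>S. det S = 1 \<and> B = A ** S)"
proof
  assume "\<exists>S. det S = 1 \<and> B = A ** S\<^sub>0 ** S"
  then obtain S where "det S = 1" "B = A ** (S\<^sub>0 ** S)"
    by (auto simp: matrix_mul_assoc)
  then show "\<exists>S. det S = 1 \<and> B = A ** S"
    using assms by (intro exI[of _ "S\<^sub>0 ** S"]) (simp add: det_mul)
next
  assume "\<exists>S. det S = 1 \<and> B = A ** S"
  then obtain S where S: "det S = 1" "B = A ** S" by blast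
  obtain T where T: "S\<^sub>0 ** T = mat 1" "det T = 1" using SL2_right_inverse[OF assms] .
  have "A ** S\<^sub>0 ** (T ** S) = A ** ((S\<^sub>0 ** T) ** S)"
    by (simp only: matrix_mul_assoc)
  then have "B = A ** S\<^sub>0 ** (T ** S)"
    using S T by simp
  then show "\<exists>S. det S = 1 \<and> B = A ** S\<^sub>0 ** S"
    using S T by (intro exI[of _ "T ** S"]) (simp add: det_mul)
qed

section \<open>Diagonalised subgroups of \<open>SL\<^sub>3\<close>\<close>

lemma diag3_nth:
  "diag3 a b c $ i $ j = (if i = j then (if i = 1 then a else if i = 2 then b else c) else 0)"
  by (simp add: diag3_def)

lemma diag3_mult: "diag3 a b c ** diag3 a' b' c' = diag3 (a * a') (b * b') (c * c' :: 'a::semiring_1)"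
proof -
  have "(diag3 a b c ** diag3 a' b' c') $ i $ j = diag3 a b c $ i $ i * diag3 a' b' c' $ i $ j" for i j
  proof -
    have "(diag3 a b c ** diag3 a' b' c') $ i $ j = (\<Sum>k\<in>UNIV. diag3 a b c $ i $ k * diag3 a' b' c' $ k $ j)"
      by (simp add: matrix_matrix_mult_def)
    also have "\<dots> = (\<Sum>k\<in>UNIV. if k = i then diag3 a b c $ i $ i * diag3 a' b' c' $ i $ j else 0)"
      by (rule sum.cong) (auto simp: diag3_nth)
    finally show ?thesis by simp
  qed
  then show ?thesis by (simp add: vec_eq_iff diag3_nth)
qed

lemma diag3_eq_iff: "diag3 a b c = diag3 a' b' c' \<longleftrightarrow> a = a' \<and> b = b' \<and> c = (c' :: 'a::zero)"
proof
  assume "diag3 a b c = diag3 a' b' c'"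
  then have "diag3 a b c $ i $ i = diag3 a' b' c' $ i $ i" for i by simp
  from this[of 1] this[of 2] this[of 3] show "a = a' \<and> b = b' \<and> c = c'"
    by (simp add: diag3_nth)
qed simp

lemma diag3_1: "diag3 1 1 1 = (mat 1 :: 'a::zero_neq_one^3^3)"
  by (simp add: vec_eq_iff diag3_nth mat_def)

lemma det_diag3: "det (diag3 a b c) = a * b * (c :: 'a::comm_ring_1)"
proof -
  have "det (diag3 a b c) = prod (\<lambda>i. diag3 a b c $ i $ i) (UNIV :: 3 set)"
    by (rule det_diagonal) (simp add: diag3_nth)
  also have "\<dots> = a * b * c"
    unfolding UNIV_3 by (simp add: diag3_nth ac_simps)
  finally show ?thesis .
qed

lemma char_decomposition_diag3_mult:
  assumes "char_decomposition G P r1 r2 r3" "g \<in> G" "h \<in> G" "g ** h \<in> G"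
  shows "diag3 (r1 (g ** h)) (r2 (g ** h)) (r3 (g ** h))
    = diag3 (r1 g * r1 h) (r2 g * r2 h) (r3 g * r3 h)"
proof -
  let ?D = "\<lambda>g. diag3 (r1 g) (r2 g) (r3 g)"
  have eq: "x ** P = P ** ?D x" if "x \<in> G" for x
    using assms(1) that by (simp add: char_decomposition_def)
  obtain Q where Q: "Q ** P = mat 1"
    using assms(1) by (auto simp: char_decomposition_def invertible_def)
  have "P ** ?D (g ** h) = g ** (h ** P)"
    using eq[OF assms(4)] by (simp add: matrix_mul_assoc)
  also have "\<dots> = P ** (?D g ** ?D h)"
    using eq[OF assms(2)] eq[OF assms(3)] by (simp add: matrix_mul_assoc)
  finally have "Q ** (P ** ?D (g ** h)) = Q ** (P ** (?D g ** ?D h))" by simp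
  then show ?thesis
    using Q by (simp add: matrix_mul_assoc diag3_mult)
qed

lemma char_decomposition_det:
  assumes "char_decomposition G P r1 r2 r3" "g \<in> G"
  shows "det g = r1 g * r2 g * r3 g"
proof -
  have "det g * det P = det (P ** diag3 (r1 g) (r2 g) (r3 g))"
    using assms by (simp add: char_decomposition_def flip: det_mul)
  also have "\<dots> = det P * (r1 g * r2 g * r3 g)"
    by (simp add: det_mul det_diag3)
  finally have "det g * det P = det P * (r1 g * r2 g * r3 g)" .
  moreover have "det P \<noteq> 0"
    using assms(1) by (simp add: char_decomposition_def invertible_det_nz)
  ultimately show ?thesis by simp
qed

lemma char_decomposition_eq_mat_1:
  assumes "char_decomposition G P r1 r2 r3" "g \<in> G" "r1 g = 1" "r2 g = 1" "r3 g = 1"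
  shows "g = mat 1"
proof -
  obtain Q where Q: "P ** Q = mat 1"
    using assms(1) by (auto simp: char_decomposition_def invertible_def)
  have "g ** P = P"
    using assms by (simp add: char_decomposition_def diag3_1)
  then have "g ** (P ** Q) = P ** Q"
    by (simp add: matrix_mul_assoc)
  then show ?thesis using Q by simp
qed

definition matrix_group :: "('a::semiring_1^'n^'n) set \<Rightarrow> ('a^'n^'n) monoid" where
  "matrix_group G = \<lparr>carrier = G, mult = (**), one = mat 1\<rparr>"

lemma finite_group_matrix_group:
  assumes "finite G" "subgroup_SL3 G"
  shows "finite_group (matrix_group G)"
proof -
  have "group (matrix_group G)"
    using assms(2) unfolding subgroup_SL3_def
    by (intro groupI) (auto simp: matrix_group_def matrix_mul_assoc)
  then show ?thesis
    using assms(1) by (simp add: finite_group_def finite_group_axioms_def matrix_group_def)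
qed

lemma
  assumes "subgroup_SL3 G" "char_decomposition G P r1 r2 r3"
  shows character_char_decomposition:
      "character (matrix_group G) r1" "character (matrix_group G) r2"
    and char_decomposition_faithful:
      "\<forall>g\<in>G. r1 g = 1 \<longrightarrow> r2 g = 1 \<longrightarrow> g = mat 1"
proof -
  have det: "r1 g * r2 g * r3 g = 1" if "g \<in> G" for g
    using assms that char_decomposition_det by (fastforce simp: subgroup_SL3_def)
  have mult: "r1 (g ** h) = r1 g * r1 h" "r2 (g ** h) = r2 g * r2 h" if "g \<in> G" "h \<in> G" for g h
    using char_decomposition_diag3_mult[OF assms(2) that] assms(1) that
    by (simp_all add: diag3_eq_iff subgroup_SL3_def)
  have nonzero: "r1 g \<noteq> 0" "r2 g \<noteq> 0" if "g \<in> G" for g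
    using det[OF that] by auto
  show "character (matrix_group G) r1" "character (matrix_group G) r2"
    using nonzero mult by (auto simp: character_def matrix_group_def)
  show "\<forall>g\<in>G. r1 g = 1 \<longrightarrow> r2 g = 1 \<longrightarrow> g = mat 1"
    using det char_decomposition_eq_mat_1[OF assms(2)] by force
qed

lemma relation_matrix_iff_columns:
  "relation_matrix G r1 r2 B \<longleftrightarrow> (\<forall>j. column j B \<in> relation_lattice (matrix_group G) r1 r2)"
  by (simp add: relation_matrix_def relation_lattice_def column_def matrix_group_def)

theorem proposition6p5:
  fixes G :: "('k::{field_char_0, alg_closed_field} ^3^3) set"
    and P :: "'k^3^3"
    and rho1 rho2 rho3 :: "'k^3^3 \<Rightarrow> 'k"
    and n :: nat
  assumes "finite G" and "subgroup_SL3 G"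
    and "\<forall>g\<in>G. \<forall>h\<in>G. g ** h = h ** g"
    and "n = card G"
    and "char_decomposition G P rho1 rho2 rho3"
  shows "(\<exists>B. relation_matrix G rho1 rho2 B \<and> det B = int n)
    \<and> (\<forall>B. relation_matrix G rho1 rho2 B \<and> det B = int n \<longrightarrow>
          (\<forall>B'. (relation_matrix G rho1 rho2 B' \<and> det B' = int n) \<longleftrightarrow>
                (\<exists>S :: int^2^2. det S = 1 \<and> B' = B ** S)))"
proof -
  interpret finite_group "matrix_group G"
    using finite_group_matrix_group[OF assms(1,2)] .
  obtain B\<^sub>0 where det_B\<^sub>0: "det B\<^sub>0 = int n"
    and lattice: "relation_lattice (matrix_group G) rho1 rho2 = range ((*v) B\<^sub>0)"
    using relation_lattice_eq_range[OF character_char_decomposition[OF assms(2,5)]]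
      char_decomposition_faithful[OF assms(2,5)] assms(4)
    by (auto simp: order_def matrix_group_def)
  have "det B\<^sub>0 \<noteq> 0"
    using det_B\<^sub>0 order_pos assms(4) by (simp add: order_def matrix_group_def)
  then have relation_matrix_iff:
    "relation_matrix G rho1 rho2 B \<and> det B = int n \<longleftrightarrow> (\<exists>S. det S = 1 \<and> B = B\<^sub>0 ** S)" for B
    using columns_in_range_det_eq_iff[of B\<^sub>0 B] det_B\<^sub>0
    by (simp add: relation_matrix_iff_columns lattice)
  have "\<exists>B S. det S = 1 \<and> B = B\<^sub>0 ** (S :: int^2^2)"
    using det_I matrix_mul_rid by blast
  moreover have "(\<exists>S. det S = 1 \<and> B' = B\<^sub>0 ** S) \<longleftrightarrow> (\<exists>S. det S = 1 \<and> B' = B ** S)"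
    if "\<exists>S. det S = 1 \<and> B = B\<^sub>0 ** S" for B B' :: "int^2^2"
    using that SL2_coset_eq[of _ B' B\<^sub>0] by auto
  ultimately show ?thesis
    unfolding relation_matrix_iff by blast
qed

end
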